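(* Let $n\ge 1$ and let $B$ be any string of length $n$ over $\{\mathrm{H},\mathrm{T}\}$, chosen by Bob. If Alice chooses her string after Bob, she can force a win for herself, and moreover in $n$ moves: there exists a string $A\neq B$ of length $n$ such that Alice wins the No-Flippancy game with Alice's string $A$ and Bob's string $B$ on move $n$.
   Context: No-Flippancy game: Alice and Bob have distinct strings $A=A_1\cdots A_n$ and $B=B_1\cdots B_n$ of the same length $n$ over the alphabet $\{\mathrm{H},\mathrm{T}\}$. Starting from the empty sequence, the players alternate turns, Alice going first, and on each turn the current player appends one letter to the sequence (the game output) as follows: let $i<n$ be the maximal length of a suffix of the current sequence that coincides with a prefix of the current player's string ($i=0$ is allowed, via the empty suffix); the player appends the letter with index $i+1$ of their own string. The game ends as soon as $A$ or $B$ appears as a block of consecutive letters in the sequence (necessarily as its suffix, no matter who made the last move); the player whose string appears first wins. If neither string ever appears, the game is infinite. The moves (turns) of both players are counted together: the $k$-th move is the one that appends the $k$-th letter. *)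

theory Defs
  imports Main "HOL-Library.Sublist"
begin

datatype letter = H | T

definition overlap :: "letter list \<Rightarrow> letter list \<Rightarrow> nat" where
  "overlap P s = Max {i. i < length P \<and> suffix (take i P) s}"

text \<open>Lists are indexed from 0, so the letter with index \<open>i + 1\<close> of the player's string is \<open>P ! i\<close>.\<close>
definition next_letter :: "letter list \<Rightarrow> letter list \<Rightarrow> letter" where
  "next_letter P s = P ! overlap P s"

definition game_over :: "letter list \<Rightarrow> letter list \<Rightarrow> letter list \<Rightarrow> bool" where
  "game_over A B s \<longleftrightarrow> sublist A s \<or> sublist B s"

text \<open>
  \<open>play A B k\<close> is the game output after \<open>k\<close> moves, or the final output if the game has ended earlier.
  Moves are counted from 1, so move \<open>Suc k\<close> is Alice's exactly when \<open>k\<close> is even.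
\<close>
primrec play :: "letter list \<Rightarrow> letter list \<Rightarrow> nat \<Rightarrow> letter list" where
  "play A B 0 = []"
| "play A B (Suc k) =
    (let s = play A B k in
      if game_over A B s then s
      else s @ [next_letter (if even k then A else B) s])"

text \<open>
  The game ends with move \<open>k\<close> and Alice is the winner, regardless of who made that move.
  For distinct strings of equal length the conjunct excluding \<open>B\<close> is redundant, because
  both cannot be completed by the same letter.
\<close>
definition alice_wins_on_move :: "letter list \<Rightarrow> letter list \<Rightarrow> nat \<Rightarrow> bool" where
  "alice_wins_on_move A B k \<longleftrightarrow>
    (\<forall>j<k. \<not> game_over A B (play A B j)) \<and>
    sublist A (play A B k) \<and> \<not> sublist B (play A B k)"

end

theory Submission
  imports Defs
begin

text \<open>
  Bob's moves do not depend on Alice's string. So let the game output be produced by Bob's rule and by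
  arbitrary moves of Alice, the first of which differs from the first letter of \<open>B\<close>, and let \<open>A\<close>
  be the output after \<open>n\<close> moves. Since the output is always a prefix of \<open>A\<close>, Alice's rule with
  string \<open>A\<close> prescribes exactly these moves.
\<close>

text \<open>No suffix of the output is longer than \<open>k\<close>, and \<open>k\<close> itself
  qualifies. So a player whose string properly extends the output continues along it.\<close>

lemma overlap_take:
  assumes "k < length P"
  shows "overlap P (take k P) = k"
  unfolding overlap_def
proof (rule Max_eqI)
  show "i \<le> k" if "i \<in> {i. i < length P \<and> suffix (take i P) (take k P)}" for i
    using that suffix_length_le[of "take i P" "take k P"] assms by simp
qed (use assms in auto)

text \<open>Alice's free moves are all the constant \<open>x\<close>; only the first has to avoid
  the first letter of \<open>B\<close>.\<close>

primrec outcome :: "letter \<Rightarrow> letter list \<Rightarrow> nat \<Rightarrow> letter list" where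
  "outcome x B 0 = []"
| "outcome x B (Suc k) = outcome x B k @ [if even k then x else next_letter B (outcome x B k)]"

lemma length_outcome [simp]: "length (outcome x B k) = k"
  by (induction k) auto

lemma take_outcome: "k \<le> m \<Longrightarrow> take k (outcome x B m) = outcome x B k"
  by (induction m) (auto simp: le_Suc_eq)

lemma not_game_over:
  assumes "length s < length A" "length s < length B"
  shows "\<not> game_over A B s"
  using assms sublist_length_le[of A s] sublist_length_le[of B s] by (auto simp: game_over_def)

lemma play_outcome:
  assumes "k \<le> length B"
  shows "play (outcome x B (length B)) B k = outcome x B k"
  using assms
proof (induction k)
  case (Suc k)
  let ?A = "outcome x B (length B)" and ?s = "outcome x B k"
  have "next_letter ?A ?s = ?A ! k"
    using Suc.prems overlap_take[of k ?A] by (simp add: next_letter_def take_outcome)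
  \<comment> \<open>Later moves only append, so index \<open>k\<close> is settled by move
    \<open>Suc k\<close>.\<close>
  also have "\<dots> = outcome x B (Suc k) ! k"
    using Suc.prems by (metis lessI nth_take take_outcome)
  also have "\<dots> = (if even k then x else next_letter B ?s)"
    by (simp add: nth_append)
  finally show ?case
    using Suc not_game_over[of ?s ?A B] by (simp add: Let_def)
qed simp

lemma nth_0_outcome: "k > 0 \<Longrightarrow> outcome x B k ! 0 = x"
  by (induction k) (auto simp: nth_append)

theorem lemma8:
  fixes n :: nat and B :: "letter list"
  assumes "n \<ge> 1" and "length B = n"
  shows "\<exists>A. length A = n \<and> A \<noteq> B \<and> alice_wins_on_move A B n"
proof -
  obtain x where x: "x \<noteq> B ! 0"
    by (metis letter.distinct(1))
  let ?A = "outcome x B n"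
  have neq: "?A \<noteq> B"
    using x assms(1) nth_0_outcome[of n x B] by auto
  have play: "play ?A B k = outcome x B k" if "k \<le> n" for k
    using play_outcome[of k B x] that assms(2) by simp
  \<comment> \<open>As the lengths agree, an occurrence of \<open>B\<close> would fill all of
    \<open>?A\<close>.\<close>
  have "\<not> sublist B ?A"
  proof
    assume "sublist B ?A"
    then obtain ps ss where eq: "?A = ps @ B @ ss"
      by (auto simp: sublist_def)
    then have "length ps + length ss = 0"
      using assms(2) length_outcome[of x B n] by simp
    with eq neq show False
      by simp
  qed
  then have "alice_wins_on_move ?A B n"
    using assms(2) by (simp add: alice_wins_on_move_def play not_game_over)
  with neq show ?thesis
    by (intro exI[of _ ?A]) simp
qed

end
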